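(* Let $n\ge 1$ and $K,L\in\mathcal{K}^n_n$. There is a continuous path $\gamma:[0,1]\to\mathcal{K}^n_n$ (with respect to the metric $\Delta_{\mathrm{Vol}}$) such that $$\gamma(0)=K,\quad \gamma(1)=L\quad\text{and}\quad L(\gamma)=\Delta_{\mathrm{Vol}}(K,L)$$ if and only if there exists $M\in\mathcal{K}^n_n$ such that $$K\cap L\subseteq M\subseteq K\cup L\ \text{ (up to Lebesgue-null sets)}\quad\text{and}\quad M\cap K\in\mathcal{K}^n_n,\ M\cap L\in\mathcal{K}^n_n.$$ In particular, there is never a geodesic segment joining disjoint bodies $K,L\in\mathcal{K}^n_n$, and thus $(\mathcal{K}^n_n,\Delta_{\mathrm{Vol}})$ is not a geodesic space for any $n$.
   Context: $\mathcal{K}^n_n$ is the set of compact convex subsets of $\mathbb{R}^n$ with affine dimension $n$ (i.e. nonempty interior). $\Delta_{\mathrm{Vol}}(K,L)=\mathrm{Vol}(K)+\mathrm{Vol}(L)-2\mathrm{Vol}(K\cap L)$ is the symmetric difference metric on $\mathcal{K}^n_n$, with $\mathrm{Vol}$ the Lebesgue measure. "$A\subseteq B$ up to null sets" means $\mathrm{Vol}(A\setminus B)=0$. The length of a continuous path $\gamma:[0,1]\to(\mathcal{K}^n_n,\Delta_{\mathrm{Vol}})$ is $L(\gamma)=\sup\sum_{i=1}^N\Delta_{\mathrm{Vol}}(\gamma(p_{i-1}),\gamma(p_i))$ over partitions $\{p_i\}_{i=0}^N$ of $[0,1]$. A geodesic segment joining $K$ and $L$ is a continuous path $\gamma:[0,1]\to\mathcal{K}^n_n$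 from $K$ to $L$ with $L(\gamma)=\Delta_{\mathrm{Vol}}(K,L)$; a geodesic space is a metric space in which any two points are joined by a geodesic segment. *)

theory Defs
  imports "HOL-Analysis.Analysis"
begin

context Metric_space
begin

(* The length may be infinite, hence the type ereal.  Only the values of g on {0..1} matter;
   a partition is 0 = p 0 < p 1 < ... < p N = 1, which forces N > 0. *)
definition path_length :: "(real \<Rightarrow> 'a) \<Rightarrow> ereal" where
  "path_length g =
    Sup {ereal (\<Sum>i=1..N. d (g (p (i - 1))) (g (p i))) | (N :: nat) (p :: nat \<Rightarrow> real).
           p 0 = 0 \<and> p N = 1 \<and> (\<forall>i<N. p i < p (Suc i))}"

definition geodesic_segment :: "'a \<Rightarrow> 'a \<Rightarrow> (real \<Rightarrow> 'a) \<Rightarrow> bool" where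
  "geodesic_segment x y g \<longleftrightarrow>
     pathin mtopology g \<and> g 0 = x \<and> g 1 = y \<and> path_length g = ereal (d x y)"

definition geodesic_space :: bool where
  "geodesic_space \<longleftrightarrow> (\<forall>x\<in>M. \<forall>y\<in>M. \<exists>g. geodesic_segment x y g)"

end

definition convex_bodies :: "(real ^ 'n) set set" where
  "convex_bodies = {K. compact K \<and> convex K \<and> aff_dim K = int CARD('n)}"

(* The value 0 outside convex_bodies is junk: the locale Metric_space requires a function that
   is nonnegative on the whole type. *)
definition Delta_Vol :: "(real ^ 'n) set \<Rightarrow> (real ^ 'n) set \<Rightarrow> real" where
  "Delta_Vol K L =
    (if K \<in> convex_bodies \<and> L \<in> convex_bodies
     then measure lebesgue K + measure lebesgue L - 2 * measure lebesgue (K \<inter> L)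
     else 0)"

definition subset_upto_null :: "(real ^ 'n) set \<Rightarrow> (real ^ 'n) set \<Rightarrow> bool" where
  "subset_upto_null A B \<longleftrightarrow> A - B \<in> null_sets lebesgue"

lemma convex_bodies_alt:
  "convex_bodies = {K :: (real ^ 'n) set. compact K \<and> convex K \<and> interior K \<noteq> {}}"
proof -
  have "aff_dim K = int CARD('n) \<longleftrightarrow> interior K \<noteq> {}" if "convex K" for K :: "(real ^ 'n) set"
  proof
    assume a: "aff_dim K = int CARD('n)"
    then have "K \<noteq> {}" by (auto simp: aff_dim_empty)
    then have "rel_interior K \<noteq> {}" using that by (simp add: rel_interior_eq_empty)
    then show "interior K \<noteq> {}" using a by (simp add: interior_rel_interior_gen)
  qed (simp add: aff_dim_nonempty_interior)
  then show ?thesis by (auto simp: convex_bodies_def)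
qed

lemma Delta_Vol_alt:
  assumes "K \<in> convex_bodies" "L \<in> convex_bodies"
  shows "Delta_Vol K L = measure lebesgue (K - L) + measure lebesgue (L - K)"
proof -
  have m: "K \<in> lmeasurable" "L \<in> lmeasurable"
    using assms by (simp_all add: convex_bodies_def lmeasurable_compact)
  have "measure lebesgue (K - L) = measure lebesgue K - measure lebesgue (K \<inter> L)"
    "measure lebesgue (L - K) = measure lebesgue L - measure lebesgue (K \<inter> L)"
    using measurable_measure_Diff[of K lebesgue "K \<inter> L"]
      measurable_measure_Diff[of L lebesgue "K \<inter> L"] m
    by (simp_all add: fmeasurable.Int fmeasurableD Diff_Int Int_commute)
  then show ?thesis using assms by (simp add: Delta_Vol_def)
qed

lemma convex_body_subset_if_null:
  assumes "K \<in> convex_bodies" "L \<in> convex_bodies" "measure lebesgue (K - L) = 0"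
  shows "K \<subseteq> L"
proof -
  have K: "compact K" "convex K" "interior K \<noteq> {}" and L: "compact L"
    using assms by (auto simp: convex_bodies_alt)
  have "K - L \<in> lmeasurable"
    using K L by (simp add: fmeasurable.Diff lmeasurable_compact)
  then have "negligible (K - L)"
    using assms(3) by (simp add: negligible_iff_measure)
  then have "negligible (interior K - L)"
    by (rule negligible_subset) (use interior_subset in blast)
  moreover have "open (interior K - L)"
    using L by (simp add: open_Diff compact_imp_closed)
  ultimately have "interior K \<subseteq> L"
    using open_not_negligible by blast
  then have "closure (interior K) \<subseteq> L"
    using L by (simp add: closure_minimal compact_imp_closed)
  then show ?thesis
    using K convex_closure_interior[of K] closure_subset[of K] by auto
qed

lemma Metric_space_convex_bodies:
  "Metric_space (convex_bodies :: (real ^ 'n) set set) Delta_Vol"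
proof
  fix K L :: "(real ^ 'n) set"
  show "0 \<le> Delta_Vol K L"
    using Delta_Vol_alt[of K L] by (cases "K \<in> convex_bodies \<and> L \<in> convex_bodies")
      (auto simp: Delta_Vol_def[of K L])
  show "Delta_Vol K L = Delta_Vol L K"
    by (simp add: Delta_Vol_def Int_commute conj_commute)
next
  fix K L :: "(real ^ 'n) set"
  assume KL: "K \<in> convex_bodies" "L \<in> convex_bodies"
  then have "Delta_Vol K L = measure lebesgue (K - L) + measure lebesgue (L - K)"
    by (intro Delta_Vol_alt)
  moreover have "0 \<le> measure lebesgue (K - L)" "0 \<le> measure lebesgue (L - K)" by simp_all
  ultimately show "Delta_Vol K L = 0 \<longleftrightarrow> K = L"
    using convex_body_subset_if_null[OF KL] convex_body_subset_if_null[OF KL(2) KL(1)]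
    by (metis Diff_cancel add_nonneg_eq_0_iff add_0 measure_empty subset_antisym)
next
  fix K L N :: "(real ^ 'n) set"
  assume A: "K \<in> convex_bodies" "L \<in> convex_bodies" "N \<in> convex_bodies"
  then have c: "compact K" "compact L" "compact N" by (auto simp: convex_bodies_def)
  have tri: "measure lebesgue (A - C) \<le> measure lebesgue (A - B) + measure lebesgue (B - C)"
    if "compact A" "compact B" "compact C" for A B C :: "(real ^ 'n) set"
  proof -
    have m: "A \<in> lmeasurable" "B \<in> lmeasurable" "C \<in> lmeasurable"
      using that by (simp_all add: lmeasurable_compact)
    have "measure lebesgue (A - C) \<le> measure lebesgue ((A - B) \<union> (B - C))"
      using m by (intro measure_mono_fmeasurable) (auto intro: fmeasurable.Diff fmeasurableD)
    also have "\<dots> \<le> measure lebesgue (A - B) + measure lebesgue (B - C)"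
      using m by (intro measure_Un_le) (auto intro: fmeasurableD)
    finally show ?thesis .
  qed
  show "Delta_Vol K N \<le> Delta_Vol K L + Delta_Vol L N"
    using tri[OF c] tri[OF c(3,2,1)] A by (simp add: Delta_Vol_alt)
qed

end

theory Submission
  imports Defs
begin

text \<open>
  In any metric space the endpoints of a geodesic segment satisfy
  \<open>d x (\<gamma> t) + d (\<gamma> t) y = d x y\<close>. For the symmetric difference metric the excess of a detour
  over \<open>M\<close> is exactly twice the volume of \<open>M - (K \<union> L)\<close> plus twice the volume of
  \<open>K \<inter> L - M\<close> (lemma \<open>Delta_Vol_detour\<close>), so the points between \<open>K\<close> and \<open>L\<close> are the bodies
  \<open>M\<close> with \<open>K \<inter> L \<subseteq> M \<subseteq> K \<union> L\<close> up to null sets.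

  Suppose a geodesic exists. If \<open>K \<inter> L\<close> has positive volume, then \<open>M = K\<close> is a witness.
  Otherwise the volumes of \<open>\<gamma> t \<inter> K\<close> and \<open>\<gamma> t \<inter> L\<close> are continuous in \<open>t\<close>; the first is the
  larger one at \<open>t = 0\<close> and the smaller one at \<open>t = 1\<close>, so they agree at some \<open>t\<close>. Their sum is at
  least the volume of \<open>\<gamma> t\<close>, so both are positive there, and \<open>M = \<gamma> t\<close> is a witness.

  Conversely, a witness \<open>M\<close> allows the chain \<open>K \<supseteq> K \<inter> M \<subseteq> M \<supseteq> M \<inter> L \<subseteq> L\<close>. Nested bodies
  \<open>C \<subseteq> K\<close> are joined by the monotone path \<open>K \<inter> s C\<close>, where the dilation \<open>s C\<close> about an interior point
  of \<open>C\<close> grows until it swallows \<open>K\<close>; its length is the difference of the volumes. The four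
  lengths add up to \<open>Delta_Vol K M + Delta_Vol M L\<close>, which is \<open>Delta_Vol K L\<close>.

  If \<open>K\<close> and \<open>L\<close> are disjoint, the interior of a witness \<open>M\<close> would be contained in the disjoint
  union of the closed sets \<open>K\<close> and \<open>L\<close> and meet both of them, which contradicts its
  connectedness. Two distant balls then show that the space is not geodesic.
\<close>

section \<open>Paths of controlled length in a metric space\<close>

context Metric_space
begin

lemma path_length_ge_sum:
  assumes "p 0 = 0" "p N = 1" "\<And>i. i < N \<Longrightarrow> p i < p (Suc i)"
  shows "ereal (\<Sum>i=1..N. d (g (p (i - 1))) (g (p i))) \<le> path_length g"
  unfolding path_length_def using assms by (intro Sup_upper) blast

lemma path_length_ge_dist: "ereal (d (g 0) (g 1)) \<le> path_length g"
  using path_length_ge_sum[of real 1 g] by simp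

lemma path_length_ge_detour:
  assumes "0 < t" "t < 1"
  shows "ereal (d (g 0) (g t) + d (g t) (g 1)) \<le> path_length g"
proof -
  define p where "p i = (if i = 0 then 0 else if i = 1 then t else 1)" for i :: nat
  have "ereal (\<Sum>i=1..2. d (g (p (i - 1))) (g (p i))) \<le> path_length g"
    using assms by (intro path_length_ge_sum) (auto simp: p_def)
  then show ?thesis by (simp add: p_def numeral_2_eq_2)
qed

lemma geodesic_segment_detour_le:
  assumes "geodesic_segment x y g" "0 < t" "t < 1"
  shows "d x (g t) + d (g t) y \<le> d x y"
  using path_length_ge_detour[OF assms(2,3), of g] assms(1)
  by (simp add: geodesic_segment_def)

lemma continuous_on_Lipschitz_pathin:
  assumes g: "pathin mtopology g"
    and f: "\<And>x y. x \<in> M \<Longrightarrow> y \<in> M \<Longrightarrow> \<bar>f x - f y\<bar> \<le> B * d x y"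
  shows "continuous_on {0..1} (\<lambda>t. f (g t) :: real)"
proof -
  have "\<exists>r>0. \<forall>s\<in>{0..1}. dist s t < r \<longrightarrow> dist (f (g s)) (f (g t)) < e"
    if t: "t \<in> {0..1}" and "e > 0" for t e
  proof -
    (* Adding 1 avoids a division by zero and allows any sign of B. *)
    define e' where "e' = e / (\<bar>B\<bar> + 1)"
    have "e' > 0" using \<open>e > 0\<close> by (simp add: e'_def)
    then have "\<exists>U. openin (subtopology euclideanreal {0..1}) U \<and> t \<in> U \<and>
        (\<forall>s\<in>U. g s \<in> mball (g t) e')"
      using g t unfolding pathin_def continuous_map_to_metric by simp
    then obtain U where U: "openin (subtopology euclideanreal {0..1}) U" "t \<in> U"
      "\<And>s. s \<in> U \<Longrightarrow> g s \<in> mball (g t) e'" by blast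
    then obtain r where r: "r > 0" "\<And>s. s \<in> {0..1} \<Longrightarrow> dist s t < r \<Longrightarrow> s \<in> U"
      unfolding openin_euclidean_subtopology_iff by metis
    have "dist (f (g s)) (f (g t)) < e" if "s \<in> {0..1}" "dist s t < r" for s
    proof -
      have s: "g s \<in> M" "g t \<in> M" "d (g s) (g t) < e'"
        using U(3)[OF r(2)[OF that]] by (simp_all add: commute)
      have "\<bar>f (g s) - f (g t)\<bar> \<le> B * d (g s) (g t)" using s by (intro f)
      also have "\<dots> \<le> (\<bar>B\<bar> + 1) * d (g s) (g t)" by (intro mult_right_mono) auto
      also have "\<dots> < (\<bar>B\<bar> + 1) * e'" using s by (intro mult_strict_left_mono) auto
      also have "\<dots> = e" by (simp add: e'_def)
      finally show ?thesis by (simp add: dist_real_def)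
    qed
    then show ?thesis using r(1) by blast
  qed
  then show ?thesis unfolding continuous_on_iff by blast
qed

text \<open>
  Such a \<open>V\<close> certifies that the path has length at most \<open>c\<close>, since its increments telescope over
  every partition, and that it is continuous. Working with a bound on increments instead of a
  supremum over partitions makes concatenation easy: no partition has to be refined at the
  junction.
\<close>
definition joined_at_cost :: "'a \<Rightarrow> 'a \<Rightarrow> real \<Rightarrow> bool" where
  "joined_at_cost x y c \<longleftrightarrow> (\<exists>(g :: real \<Rightarrow> 'a) V.
     (\<forall>t\<in>{0..1}. g t \<in> M) \<and> continuous_on {0..1} V \<and>
     (\<forall>s\<in>{0..1}. \<forall>t\<in>{0..1}. s \<le> t \<longrightarrow> d (g s) (g t) \<le> V t - V s) \<and>
     g 0 = x \<and> g 1 = y \<and> V 1 - V 0 = c)"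

lemma joined_at_cost_sym:
  assumes "joined_at_cost x y c"
  shows "joined_at_cost y x c"
proof -
  obtain g :: "real \<Rightarrow> 'a" and V where gV: "\<And>t. t \<in> {0..1} \<Longrightarrow> g t \<in> M" "continuous_on {0..1} V"
    "\<And>s t. s \<in> {0..1} \<Longrightarrow> t \<in> {0..1} \<Longrightarrow> s \<le> t \<Longrightarrow> d (g s) (g t) \<le> V t - V s"
    "g 0 = x" "g 1 = y" "V 1 - V 0 = c"
    using assms unfolding joined_at_cost_def by blast
  define h W where "h t = g (1 - t)" and "W t = - V (1 - t)" for t :: real
  have "continuous_on {0..1} W"
    unfolding W_def by (intro continuous_intros continuous_on_compose2[OF gV(2)]) auto
  moreover have "d (h s) (h t) \<le> W t - W s" if "s \<in> {0..1}" "t \<in> {0..1}" "s \<le> t" for s t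
    using gV(3)[of "1 - t" "1 - s"] that by (simp add: h_def W_def commute)
  moreover have "h t \<in> M" if "t \<in> {0..1}" for t using gV(1)[of "1 - t"] that by (simp add: h_def)
  moreover have "h 0 = y" "h 1 = x" "W 1 - W 0 = c" using gV by (simp_all add: h_def W_def)
  ultimately show ?thesis unfolding joined_at_cost_def by blast
qed

lemma joined_at_cost_trans:
  assumes "joined_at_cost x y b" "joined_at_cost y z c"
  shows "joined_at_cost x z (b + c)"
proof -
  obtain g :: "real \<Rightarrow> 'a" and V where g: "\<And>t. t \<in> {0..1} \<Longrightarrow> g t \<in> M" "continuous_on {0..1} V"
    "\<And>s t. s \<in> {0..1} \<Longrightarrow> t \<in> {0..1} \<Longrightarrow> s \<le> t \<Longrightarrow> d (g s) (g t) \<le> V t - V s"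
    "g 0 = x" "g 1 = y" "V 1 - V 0 = b"
    using assms(1) unfolding joined_at_cost_def by blast
  obtain h :: "real \<Rightarrow> 'a" and W where h: "\<And>t. t \<in> {0..1} \<Longrightarrow> h t \<in> M" "continuous_on {0..1} W"
    "\<And>s t. s \<in> {0..1} \<Longrightarrow> t \<in> {0..1} \<Longrightarrow> s \<le> t \<Longrightarrow> d (h s) (h t) \<le> W t - W s"
    "h 0 = y" "h 1 = z" "W 1 - W 0 = c"
    using assms(2) unfolding joined_at_cost_def by blast
  define k where "k t = (if t \<le> 1/2 then g (2 * t) else h (2 * t - 1))" for t :: real
  define U where "U t = (if t \<le> 1/2 then V (2 * t) - V 1 else W (2 * t - 1) - W 0)" for t :: real
  have "continuous_on {0..1} U"
    unfolding U_def
    by (intro continuous_on_cases_1 continuous_intros continuous_on_compose2[OF g(2)]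
        continuous_on_compose2[OF h(2)]) auto
  moreover have "k t \<in> M" if "t \<in> {0..1}" for t
    using g(1)[of "2 * t"] h(1)[of "2 * t - 1"] that by (auto simp: k_def)
  moreover have "d (k s) (k t) \<le> U t - U s"
    if st: "s \<in> {0..1}" "t \<in> {0..1}" "s \<le> t" for s t
  proof -
    consider "t \<le> 1/2" | "1/2 < s" | "s \<le> 1/2" "1/2 < t" by linarith
    then show ?thesis
    proof cases
      case 1
      then show ?thesis using g(3)[of "2 * s" "2 * t"] st by (auto simp: k_def U_def)
    next
      case 2
      then show ?thesis using h(3)[of "2 * s - 1" "2 * t - 1"] st by (auto simp: k_def U_def)
    next
      case 3
      have "d (g (2 * s)) (h (2 * t - 1)) \<le> d (g (2 * s)) y + d y (h (2 * t - 1))"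
        using g(1)[of "2 * s"] g(1)[of 1] h(1)[of "2 * t - 1"] g(5) st 3 by (intro triangle) auto
      also have "d (g (2 * s)) y \<le> V 1 - V (2 * s)"
        using g(3)[of "2 * s" 1] g(5) st 3 by auto
      also have "d y (h (2 * t - 1)) \<le> W (2 * t - 1) - W 0"
        using h(3)[of 0 "2 * t - 1"] h(4) st 3 by auto
      finally show ?thesis using 3 by (simp add: k_def U_def)
    qed
  qed
  moreover have "k 0 = x" "k 1 = z" "U 1 - U 0 = b + c"
    using g(4,6) h(5,6) by (simp_all add: k_def U_def)
  ultimately show ?thesis unfolding joined_at_cost_def by blast
qed

lemma geodesic_segment_if_joined_at_dist:
  assumes "joined_at_cost x y (d x y)"
  shows "\<exists>g. geodesic_segment x y g"
proof -
  obtain g :: "real \<Rightarrow> 'a" and V where g: "\<And>t. t \<in> {0..1} \<Longrightarrow> g t \<in> M" "continuous_on {0..1} V"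
    "\<And>s t. s \<in> {0..1} \<Longrightarrow> t \<in> {0..1} \<Longrightarrow> s \<le> t \<Longrightarrow> d (g s) (g t) \<le> V t - V s"
    "g 0 = x" "g 1 = y" "V 1 - V 0 = d x y"
    using assms unfolding joined_at_cost_def by blast
  have dist_le: "d (g s) (g t) \<le> \<bar>V t - V s\<bar>" if "s \<in> {0..1}" "t \<in> {0..1}" for s t
    using g(3)[OF that] g(3)[OF that(2,1)] commute[of "g s" "g t"] by (cases "s \<le> t") auto
  have "pathin mtopology g"
    unfolding pathin_def continuous_map_to_metric
  proof (intro ballI allI impI)
    fix t e :: real
    assume "t \<in> topspace (subtopology euclideanreal {0..1})" and e: "e > 0"
    then have t: "t \<in> {0..1}" by simp
    then obtain r where r: "r > 0" "\<And>s. s \<in> {0..1} \<Longrightarrow> dist s t < r \<Longrightarrow> dist (V s) (V t) < e"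
      using g(2) e unfolding continuous_on_iff by metis
    have "g s \<in> mball (g t) e" if "s \<in> {0..1} \<inter> ball t r" for s
      using r(2)[of s] dist_le[of t s] g(1) t that by (auto simp: dist_real_def abs_minus_commute)
    moreover have "openin (subtopology euclideanreal {0..1}) ({0..1} \<inter> ball t r)"
      by (simp add: openin_open_Int)
    ultimately show "\<exists>U. openin (subtopology euclideanreal {0..1}) U \<and> t \<in> U \<and>
        (\<forall>s\<in>U. g s \<in> mball (g t) e)"
      using t r(1) by (intro exI[of _ "{0..1} \<inter> ball t r"]) auto
  qed
  moreover have "path_length g \<le> ereal (d x y)"
    unfolding path_length_def
  proof (rule Sup_least, clarify)
    fix N :: nat and p :: "nat \<Rightarrow> real"
    assume p: "p 0 = 0" "p N = 1" "\<forall>i<N. p i < p (Suc i)"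
    have mono: "p i \<le> p j" if "i \<le> j" "j \<le> N" for i j
      using that
    proof (induction rule: dec_induct)
      case (step n)
      then show ?case using p(3)[rule_format, of n] by simp
    qed simp
    have p01: "p i \<in> {0..1}" if "i \<le> N" for i
      using mono[of 0 i] mono[of i N] p that by simp
    have "(\<Sum>i=1..N. d (g (p (i - 1))) (g (p i))) \<le> (\<Sum>i=1..N. V (p i) - V (p (i - 1)))"
      by (intro sum_mono g(3) p01 mono) auto
    also have "\<dots> = (\<Sum>i<N. V (p (Suc i)) - V (p i))"
      by (simp add: sum.atLeast1_atMost_eq)
    also have "\<dots> = d x y"
      using sum_lessThan_telescope[of "\<lambda>i. V (p i)" N] p g(6) by simp
    finally show "ereal (\<Sum>i=1..N. d (g (p (i - 1))) (g (p i))) \<le> ereal (d x y)" by simp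
  qed
  ultimately have "geodesic_segment x y g"
    using path_length_ge_dist[of g] g(4,5) by (simp add: geodesic_segment_def antisym)
  then show ?thesis by blast
qed

end

section \<open>Volumes of convex bodies\<close>

abbreviation vol :: "(real ^ 'n) set \<Rightarrow> real" where
  "vol \<equiv> measure lebesgue"

interpretation bodies: Metric_space "convex_bodies :: (real ^ 'n) set set" Delta_Vol
  by (rule Metric_space_convex_bodies)

lemma convex_bodies_lmeasurable: "K \<in> convex_bodies \<Longrightarrow> K \<in> lmeasurable"
  by (simp add: convex_bodies_def lmeasurable_compact)

lemma vol_Diff_add_Int:
  assumes "A \<in> lmeasurable" "B \<in> lmeasurable"
  shows "vol (A - B) + vol (A \<inter> B) = vol A"
  using measurable_measure_Diff[of A lebesgue "A \<inter> B"] assms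
  by (simp add: fmeasurable.Int fmeasurableD Diff_Int)

lemma convex_bodies_Int_iff:
  assumes "K \<in> convex_bodies" "L \<in> convex_bodies"
  shows "K \<inter> L \<in> convex_bodies \<longleftrightarrow> 0 < vol (K \<inter> L)"
proof -
  have KL: "compact (K \<inter> L)" "convex (K \<inter> L)"
    using assms by (auto simp: convex_bodies_def convex_Int intro: compact_Int)
  then have "interior (K \<inter> L) \<noteq> {} \<longleftrightarrow> vol (K \<inter> L) \<noteq> 0"
    using negligible_convex_interior[of "K \<inter> L"] negligible_iff_measure0[of "K \<inter> L"]
      lmeasurable_compact[of "K \<inter> L"] by auto
  then show ?thesis using KL by (auto simp: convex_bodies_alt zero_less_measure_iff)
qed

lemma convex_body_vol_pos: "K \<in> convex_bodies \<Longrightarrow> 0 < vol K"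
  using convex_bodies_Int_iff[of K K] by simp

lemma Delta_Vol_nested:
  assumes "A \<in> convex_bodies" "B \<in> convex_bodies" "A \<subseteq> B"
  shows "Delta_Vol A B = vol B - vol A" "Delta_Vol B A = vol B - vol A"
  using assms by (simp_all add: Delta_Vol_def Int_absorb1 Int_absorb2)

text \<open>
  By inclusion and exclusion, the detour over \<open>M\<close> counts twice exactly those points that have to
  be added or removed although both \<open>K\<close> and \<open>L\<close> agree about them.
\<close>
lemma Delta_Vol_detour:
  assumes "K \<in> convex_bodies" "L \<in> convex_bodies" "M \<in> convex_bodies"
  shows "Delta_Vol K M + Delta_Vol M L =
    Delta_Vol K L + 2 * vol (M - (K \<union> L)) + 2 * vol (K \<inter> L - M)"
proof -
  have m: "K \<in> lmeasurable" "L \<in> lmeasurable" "M \<in> lmeasurable"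
    using assms by (simp_all add: convex_bodies_lmeasurable)
  have "vol ((M \<inter> K) \<union> (M \<inter> L)) = vol (M \<inter> K) + vol (M \<inter> L) - vol ((M \<inter> K) \<inter> (M \<inter> L))"
    using m by (intro measure_Un3) auto
  moreover have "(M \<inter> K) \<union> (M \<inter> L) = M \<inter> (K \<union> L)" "(M \<inter> K) \<inter> (M \<inter> L) = K \<inter> L \<inter> M" by auto
  moreover have "vol (M - (K \<union> L)) + vol (M \<inter> (K \<union> L)) = vol M"
    using m by (intro vol_Diff_add_Int) auto
  moreover have "vol (K \<inter> L - M) + vol (K \<inter> L \<inter> M) = vol (K \<inter> L)"
    using m by (intro vol_Diff_add_Int) auto
  ultimately show ?thesis using assms by (simp add: Delta_Vol_def Int_commute)
qed

lemma subset_upto_null_iff: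
  assumes "A \<in> lmeasurable" "B \<in> lmeasurable"
  shows "subset_upto_null A B \<longleftrightarrow> vol (A - B) = 0"
  using assms negligible_iff_measure0[of "A - B"]
  by (simp add: subset_upto_null_def fmeasurable.Diff fmeasurableD negligible_iff_null_sets)

lemma between_iff_upto_null:
  assumes "K \<in> convex_bodies" "L \<in> convex_bodies" "M \<in> convex_bodies"
  shows "subset_upto_null (K \<inter> L) M \<and> subset_upto_null M (K \<union> L) \<longleftrightarrow>
    Delta_Vol K M + Delta_Vol M L \<le> Delta_Vol K L"
proof -
  have m: "K \<in> lmeasurable" "L \<in> lmeasurable" "M \<in> lmeasurable"
    using assms by (simp_all add: convex_bodies_lmeasurable)
  then have "subset_upto_null (K \<inter> L) M \<longleftrightarrow> vol (K \<inter> L - M) = 0"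
    "subset_upto_null M (K \<union> L) \<longleftrightarrow> vol (M - (K \<union> L)) = 0"
    by (simp_all add: subset_upto_null_iff fmeasurable.Int fmeasurable.Un fmeasurableD)
  then show ?thesis
    using Delta_Vol_detour[OF assms] measure_nonneg[of lebesgue "K \<inter> L - M"]
      measure_nonneg[of lebesgue "M - (K \<union> L)"] by argo
qed

lemma vol_Int_Lipschitz:
  assumes "A \<in> convex_bodies" "B \<in> convex_bodies" "K \<in> convex_bodies"
  shows "\<bar>vol (A \<inter> K) - vol (B \<inter> K)\<bar> \<le> Delta_Vol A B"
proof -
  have le: "vol (A \<inter> K) - vol (B \<inter> K) \<le> vol (A - B)"
    if "A \<in> lmeasurable" "B \<in> lmeasurable" "K \<in> lmeasurable" for A B K :: "(real ^ 'n) set"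
  proof -
    have "vol (A \<inter> K) \<le> vol ((B \<inter> K) \<union> (A - B))"
      using that by (intro measure_mono_fmeasurable) (auto intro: fmeasurable.Diff fmeasurableD)
    also have "\<dots> \<le> vol (B \<inter> K) + vol (A - B)"
      using that by (intro measure_Un_le) (auto intro: fmeasurableD)
    finally show ?thesis by simp
  qed
  have "vol (A \<inter> K) - vol (B \<inter> K) \<le> vol (A - B)" "vol (B \<inter> K) - vol (A \<inter> K) \<le> vol (B - A)"
    using assms by (auto intro: le convex_bodies_lmeasurable)
  then show ?thesis
    using measure_nonneg[of lebesgue "A - B"] measure_nonneg[of lebesgue "B - A"]
    unfolding Delta_Vol_alt[OF assms(1,2)] by linarith
qed

section \<open>From a geodesic to an intermediate body\<close>

lemma intermediate_body_if_geodesic: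
  fixes K L :: "(real ^ 'n) set"
  assumes K: "K \<in> convex_bodies" and L: "L \<in> convex_bodies"
    and g: "bodies.geodesic_segment K L g"
  shows "\<exists>M\<in>convex_bodies. subset_upto_null (K \<inter> L) M \<and> subset_upto_null M (K \<union> L) \<and>
    M \<inter> K \<in> convex_bodies \<and> M \<inter> L \<in> convex_bodies"
proof (cases "K \<inter> L \<in> convex_bodies")
  case True
  then show ?thesis
    using K by (intro bexI[of _ K]) (auto simp: subset_upto_null_def Diff_eq_empty_iff[THEN iffD2])
next
  case False
  then have KL0: "vol (K \<inter> L) = 0"
    using convex_bodies_Int_iff[OF K L] by (simp add: zero_less_measure_iff)
  have path: "pathin bodies.mtopology g" and ends: "g 0 = K" "g 1 = L"
    using g by (auto simp: bodies.geodesic_segment_def)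
  have body: "g t \<in> convex_bodies" if "t \<in> {0..1}" for t
    using path that by (fastforce simp: pathin_def continuous_map_def)
  (* A zero of f along g is a body that shares equal volumes with K and L. *)
  define f where "f A = vol (A \<inter> K) - vol (A \<inter> L)" for A
  have "\<bar>f A - f B\<bar> \<le> 2 * Delta_Vol A B"
    if "A \<in> convex_bodies" "B \<in> convex_bodies" for A B
    using vol_Int_Lipschitz[OF that K] vol_Int_Lipschitz[OF that L] by (simp add: f_def)
  then have "continuous_on {0..1} (\<lambda>t. f (g t))"
    by (rule bodies.continuous_on_Lipschitz_pathin[OF path])
  moreover have f0: "f (g 0) > 0" and f1: "f (g 1) < 0"
    using KL0 convex_body_vol_pos[OF K] convex_body_vol_pos[OF L]
    by (simp_all add: f_def ends Int_commute)
  ultimately obtain t where t: "0 \<le> t" "t \<le> 1" "f (g t) = 0"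
    using IVT2'[of "\<lambda>t. f (g t)" 1 0 0] by auto
  define M where "M = g t"
  have M: "M \<in> convex_bodies" using body t by (simp add: M_def)
  have "0 < t" "t < 1" using t f0 f1 by (auto simp: less_le)
  then have "Delta_Vol K M + Delta_Vol M L \<le> Delta_Vol K L"
    unfolding M_def by (rule bodies.geodesic_segment_detour_le[OF g])
  then have between: "subset_upto_null (K \<inter> L) M" "subset_upto_null M (K \<union> L)"
    using between_iff_upto_null[OF K L M] by auto
  have m: "K \<in> lmeasurable" "L \<in> lmeasurable" "M \<in> lmeasurable"
    using K L M by (simp_all add: convex_bodies_lmeasurable)
  have "vol (M - (K \<union> L)) = 0"
    using between(2) subset_upto_null_iff m by blast
  then have "vol M = vol (M \<inter> (K \<union> L))"
    using vol_Diff_add_Int[of M "K \<union> L"] m by (simp add: fmeasurable.Un)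
  also have "\<dots> \<le> vol (M \<inter> K) + vol (M \<inter> L)"
    unfolding Int_Un_distrib using m by (intro measure_Un_le) auto
  finally have "0 < vol (M \<inter> K) + vol (M \<inter> L)" using convex_body_vol_pos[OF M] by simp
  then have "M \<inter> K \<in> convex_bodies" "M \<inter> L \<in> convex_bodies"
    using t(3) K L M by (simp_all add: f_def M_def convex_bodies_Int_iff)
  then show ?thesis using M between by blast
qed

section \<open>From an intermediate body to a geodesic\<close>

text \<open>
  The dilations of \<open>C\<close> about an interior point increase with the scaling factor, their volume is a polynomial in this
  factor, and they exhaust the space. Intersecting them with \<open>K\<close> can only slow down the
  growth of the volume.
\<close>
lemma nested_bodies_joined:
  fixes C K :: "(real ^ 'n) set"
  assumes C: "C \<in> convex_bodies" and K: "K \<in> convex_bodies" and "C \<subseteq> K"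
  shows "bodies.joined_at_cost C K (vol K - vol C)"
proof -
  have C': "compact C" "convex C" and K': "compact K" "convex K"
    using C K by (auto simp: convex_bodies_def)
  obtain c where "c \<in> interior C" using C by (auto simp: convex_bodies_alt)
  then obtain e where e: "e > 0" "ball c e \<subseteq> C"
    by (meson mem_interior)
  then have cC: "c \<in> C" by auto
  obtain B where B: "\<And>x. x \<in> K \<Longrightarrow> norm (x - c) \<le> B"
    using bounded_any_center[of K c] K'(1) compact_imp_bounded
    by (metis dist_norm norm_minus_commute)
  have "B \<ge> 0" using B[of c] cC \<open>C \<subseteq> K\<close> by auto
  define S where "S r = (\<lambda>x. r *\<^sub>R x + (c - r *\<^sub>R c)) ` C" for r
  have S_iff: "x \<in> S r \<longleftrightarrow> c + (1 / r) *\<^sub>R (x - c) \<in> C" if "r > 0" for r x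
  proof
    assume "x \<in> S r"
    then obtain y where y: "y \<in> C" "x = r *\<^sub>R y + (c - r *\<^sub>R c)" by (auto simp: S_def)
    then have "x - c = r *\<^sub>R (y - c)" by (simp add: algebra_simps)
    then show "c + (1 / r) *\<^sub>R (x - c) \<in> C" using y(1) that by simp
  next
    assume "c + (1 / r) *\<^sub>R (x - c) \<in> C"
    then show "x \<in> S r"
      unfolding S_def using that by (intro image_eqI) (auto simp: algebra_simps)
  qed
  have S_mono: "S r \<subseteq> S r'" if "0 < r" "r \<le> r'" for r r'
  proof
    fix x assume "x \<in> S r"
    then have "c + (1 / r) *\<^sub>R (x - c) \<in> C" using S_iff that by simp
    then have "(1 - r / r') *\<^sub>R c + (r / r') *\<^sub>R (c + (1 / r) *\<^sub>R (x - c)) \<in> C"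
      using C'(2) cC that by (intro convexD) auto
    moreover have "(1 - r / r') *\<^sub>R c + (r / r') *\<^sub>R (c + (1 / r) *\<^sub>R (x - c))
        = c + (1 / r') *\<^sub>R (x - c)"
      using that by (simp add: algebra_simps)
    ultimately show "x \<in> S r'" using S_iff that by simp
  qed
  have S_1: "S 1 = C" by (simp add: S_def)
  have S_compact: "compact (S r)" and S_convex: "convex (S r)" for r
    unfolding S_def using C' compact_affinity[of C "c - r *\<^sub>R c" r] convex_affinity[of C "c - r *\<^sub>R c" r]
    by (simp_all add: add.commute)
  have vol_S: "vol (S r) = \<bar>r\<bar> ^ CARD('n) * vol C" for r
    using measure_lebesgue_affine[of r "c - r *\<^sub>R c" C] by (simp add: S_def)
  (* R e exceeds B, so the dilation by R turns the ball of radius e inside C into one that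
     contains K. *)
  define R where "R = B / e + 1"
  have R: "R \<ge> 1" using \<open>B \<ge> 0\<close> e by (simp add: R_def)
  have "K \<subseteq> S R"
  proof
    fix x assume "x \<in> K"
    have "norm (x - c) / R < e"
    proof -
      have "R * e = B + e" using e by (simp add: R_def field_simps)
      then have "norm (x - c) < R * e" using B[OF \<open>x \<in> K\<close>] e by linarith
      then show ?thesis using R by (simp add: field_simps)
    qed
    then have "c + (1 / R) *\<^sub>R (x - c) \<in> ball c e" using R by (simp add: dist_norm)
    then show "x \<in> S R" using S_iff[of R x] R e by auto
  qed
  define r where "r t = 1 + t * (R - 1)" for t :: real
  have r1: "1 \<le> r t" if "t \<in> {0..1}" for t using R that by (simp add: r_def)
  have r_mono: "r s \<le> r t" if "s \<le> t" for s t using R that by (simp add: r_def mult_right_mono)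
  define g where "g t = K \<inter> S (r t)" for t
  have g_mono: "g s \<subseteq> g t" if "s \<in> {0..1}" "s \<le> t" for s t
    using S_mono[of "r s" "r t"] r1[OF that(1)] r_mono[OF that(2)] by (auto simp: g_def)
  have g0: "g 0 = C" and g1: "g 1 = K"
    using \<open>C \<subseteq> K\<close> \<open>K \<subseteq> S R\<close> S_1 by (auto simp: g_def r_def)
  have body: "g t \<in> convex_bodies" if "t \<in> {0..1}" for t
  proof -
    have "interior C \<subseteq> interior (g t)"
      using g_mono[of 0 t] g0 that by (intro interior_mono) auto
    moreover have "compact (g t)" "convex (g t)"
      using K' S_compact S_convex by (auto simp: g_def intro: compact_Int convex_Int)
    ultimately show ?thesis using C by (auto simp: convex_bodies_alt)
  qed
  have vol_le: "vol (g t) - vol (g s) \<le> vol (S (r t)) - vol (S (r s))"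
    and vol_mono: "vol (g s) \<le> vol (g t)"
    if "s \<in> {0..1}" "t \<in> {0..1}" "s \<le> t" for s t
  proof -
    have m: "K \<in> lmeasurable" "S (r s) \<in> lmeasurable" "S (r t) \<in> lmeasurable"
      using K'(1) S_compact lmeasurable_compact by auto
    have sub: "S (r s) \<subseteq> S (r t)"
      using S_mono r1[OF that(1)] r_mono[OF that(3)] by auto
    show "vol (g s) \<le> vol (g t)"
      using g_mono[OF that(1,3)] body that
      by (intro measure_mono_fmeasurable) (auto simp: convex_bodies_lmeasurable fmeasurableD)
    have "vol (g t) - vol (g s) = vol (g t - g s)"
      using measurable_measure_Diff[of "g t" lebesgue "g s"] g_mono[OF that(1,3)] body that
      by (auto simp: convex_bodies_lmeasurable fmeasurableD)
    also have "\<dots> \<le> vol (S (r t) - S (r s))"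
      using m by (intro measure_mono_fmeasurable) (auto simp: g_def intro!: fmeasurableD)
    also have "\<dots> = vol (S (r t)) - vol (S (r s))"
      using measurable_measure_Diff[of "S (r t)" lebesgue "S (r s)"] m sub
      by (auto simp: fmeasurableD)
    finally show "vol (g t) - vol (g s) \<le> vol (S (r t)) - vol (S (r s))" .
  qed
  have "continuous_on {0..1} (\<lambda>t. vol (g t))"
  proof -
    have "\<bar>vol (g s) - vol (g t)\<bar> \<le> \<bar>vol (S (r s)) - vol (S (r t))\<bar>"
      if "s \<in> {0..1}" "t \<in> {0..1}" for s t
      using vol_le[of s t] vol_le[of t s] vol_mono[of s t] vol_mono[of t s] that
      by (cases "s \<le> t") auto
    moreover have "continuous_on {0..1} (\<lambda>t. vol (S (r t)))"
      unfolding vol_S r_def by (intro continuous_intros)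
    ultimately show ?thesis
      unfolding continuous_on_iff dist_real_def by (meson le_less_trans)
  qed
  moreover have "Delta_Vol (g s) (g t) \<le> vol (g t) - vol (g s)"
    if "s \<in> {0..1}" "t \<in> {0..1}" "s \<le> t" for s t
    using Delta_Vol_nested(1) body g_mono that by (metis order_refl)
  ultimately show ?thesis
    unfolding bodies.joined_at_cost_def using body g0 g1
    by (intro exI[of _ g] exI[of _ "\<lambda>t. vol (g t)"]) auto
qed

text \<open>
  The path shrinks \<open>K\<close> to \<open>K \<inter> L\<close> and then grows to \<open>L\<close>, so that nothing is removed and added again.
\<close>
lemma overlapping_bodies_joined:
  assumes "K \<in> convex_bodies" "L \<in> convex_bodies" "K \<inter> L \<in> convex_bodies"
  shows "bodies.joined_at_cost K L (Delta_Vol K L)"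
proof -
  have "bodies.joined_at_cost K (K \<inter> L) (vol K - vol (K \<inter> L))"
    "bodies.joined_at_cost (K \<inter> L) L (vol L - vol (K \<inter> L))"
    using assms by (auto intro: bodies.joined_at_cost_sym nested_bodies_joined)
  from bodies.joined_at_cost_trans[OF this] show ?thesis
    using assms by (simp add: Delta_Vol_def algebra_simps)
qed

lemma geodesic_if_intermediate_body:
  assumes K: "K \<in> convex_bodies" and L: "L \<in> convex_bodies" and M: "M \<in> convex_bodies"
    and between: "subset_upto_null (K \<inter> L) M" "subset_upto_null M (K \<union> L)"
    and body_K: "M \<inter> K \<in> convex_bodies" and body_L: "M \<inter> L \<in> convex_bodies"
  shows "\<exists>g. bodies.geodesic_segment K L g"
proof -
  have "Delta_Vol K M + Delta_Vol M L = Delta_Vol K L"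
    using between_iff_upto_null[OF K L M] between bodies.triangle[OF K M L] by auto
  moreover have "bodies.joined_at_cost K L (Delta_Vol K M + Delta_Vol M L)"
    using overlapping_bodies_joined[OF K M] overlapping_bodies_joined[OF M L] body_K body_L
    by (auto simp: Int_commute intro: bodies.joined_at_cost_trans)
  ultimately show ?thesis by (simp add: bodies.geodesic_segment_if_joined_at_dist)
qed

section \<open>Disjoint bodies\<close>

text \<open>
  The open set \<open>interior M - (K \<union> L)\<close> is null and therefore empty, so that \<open>K\<close> and \<open>L\<close>
  separate the connected set \<open>interior M\<close>.
\<close>
lemma no_intermediate_body_if_disjoint:
  fixes K L M :: "(real ^ 'n) set"
  assumes K: "K \<in> convex_bodies" and L: "L \<in> convex_bodies" and "K \<inter> L = {}"
    and M: "M \<in> convex_bodies" and sub: "subset_upto_null M (K \<union> L)"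
    and body_K: "M \<inter> K \<in> convex_bodies" and body_L: "M \<inter> L \<in> convex_bodies"
  shows False
proof -
  have closed: "closed K" "closed L"
    using K L by (auto simp: convex_bodies_def compact_imp_closed)
  have "negligible (M - (K \<union> L))"
    using sub by (simp add: subset_upto_null_def negligible_iff_null_sets)
  then have "negligible (interior M - (K \<union> L))"
    by (rule negligible_subset) (use interior_subset in blast)
  moreover have "open (interior M - (K \<union> L))" using closed by (simp add: open_Diff closed_Un)
  ultimately have "interior M \<subseteq> K \<union> L" using open_not_negligible by blast
  moreover have "connected (interior M)"
    using M by (simp add: convex_bodies_def convex_connected convex_interior)
  ultimately have "K \<inter> interior M = {} \<or> L \<inter> interior M = {}"
    using connected_closedD[of "interior M" K L] \<open>K \<inter> L = {}\<close> closed by auto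
  moreover have "interior (M \<inter> K) \<noteq> {}" "interior (M \<inter> L) \<noteq> {}"
    using body_K body_L by (auto simp: convex_bodies_alt)
  ultimately show False using interior_subset by fastforce
qed

lemma no_geodesic_if_disjoint:
  assumes "K \<in> convex_bodies" "L \<in> convex_bodies" "K \<inter> L = {}"
  shows "\<not> bodies.geodesic_segment K L g"
  using intermediate_body_if_geodesic[of K L g] no_intermediate_body_if_disjoint[of K L] assms
  by blast

lemma exists_disjoint_bodies:
  "\<exists>K\<in>(convex_bodies :: (real ^ 'n) set set). \<exists>L\<in>convex_bodies. K \<inter> L = {}"
proof -
  obtain b :: "real ^ 'n" where b: "norm b = 3" using vector_choose_size[of 3, where 'a = "real ^ 'n"] by auto
  have "cball 0 1 \<inter> cball b 1 = {}"
    using b disjoint_cballI[of 1 1 0 b] by (simp add: dist_norm)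
  moreover have "cball 0 1 \<in> (convex_bodies :: (real ^ 'n) set set)" "cball b 1 \<in> convex_bodies"
    by (simp_all add: convex_bodies_alt)
  ultimately show ?thesis by blast
qed

section \<open>The characterization of joinable bodies\<close>

theorem theorem1p4:
  shows
    "(\<forall>K \<in> (convex_bodies :: (real ^ 'n) set set). \<forall>L \<in> convex_bodies.
        (\<exists>\<gamma>. pathin (Metric_space.mtopology convex_bodies Delta_Vol) \<gamma> \<and>
             \<gamma> 0 = K \<and> \<gamma> 1 = L \<and>
             Metric_space.path_length Delta_Vol \<gamma> = ereal (Delta_Vol K L)) \<longleftrightarrow>
        (\<exists>M \<in> convex_bodies.
             subset_upto_null (K \<inter> L) M \<and> subset_upto_null M (K \<union> L) \<and>
             M \<inter> K \<in> convex_bodies \<and> M \<inter> L \<in> convex_bodies)) \<and>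
     (\<forall>K \<in> (convex_bodies :: (real ^ 'n) set set). \<forall>L \<in> convex_bodies.
        K \<inter> L = {} \<longrightarrow>
        \<not> (\<exists>\<gamma>. Metric_space.geodesic_segment convex_bodies Delta_Vol K L \<gamma>)) \<and>
     \<not> Metric_space.geodesic_space (convex_bodies :: (real ^ 'n) set set) Delta_Vol"
proof (intro conjI ballI impI)
  fix K L :: "(real ^ 'n) set"
  assume KL: "K \<in> convex_bodies" "L \<in> convex_bodies"
  show "(\<exists>\<gamma>. pathin bodies.mtopology \<gamma> \<and> \<gamma> 0 = K \<and> \<gamma> 1 = L \<and>
        bodies.path_length \<gamma> = ereal (Delta_Vol K L)) \<longleftrightarrow>
      (\<exists>M \<in> convex_bodies. subset_upto_null (K \<inter> L) M \<and> subset_upto_null M (K \<union> L) \<and>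
        M \<inter> K \<in> convex_bodies \<and> M \<inter> L \<in> convex_bodies)"
    unfolding bodies.geodesic_segment_def[symmetric]
    using intermediate_body_if_geodesic[OF KL] geodesic_if_intermediate_body[OF KL] by blast
next
  fix K L :: "(real ^ 'n) set"
  assume "K \<in> convex_bodies" "L \<in> convex_bodies" "K \<inter> L = {}"
  then show "\<not> (\<exists>\<gamma>. bodies.geodesic_segment K L \<gamma>)" by (simp add: no_geodesic_if_disjoint)
next
  show "\<not> Metric_space.geodesic_space (convex_bodies :: (real ^ 'n) set set) Delta_Vol"
    using exists_disjoint_bodies no_geodesic_if_disjoint
    unfolding bodies.geodesic_space_def by blast
qed

end
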